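(* Let $X$ be a Hilbert space and let $T$ be a closed linear subspace of $X\times X$. Then $$T_s=\hat T_s=\big(G(Q_T|_{T(0)^{\perp}})\big)^{-1}\,\tilde T_s .$$
   Context: For linear spaces $X,Y$, $LR(X,Y)$ is the set of all linear subspaces of $X\times Y$, $LR(X)=LR(X,X)$. For $T\in LR(X,Y)$: $D(T)$ is its domain, $T(x)=\{y\in Y:(x,y)\in T\}$, $T^{-1}=\{(y,x):(x,y)\in T\}$. A (single-valued) linear operator is identified with its graph, and $G(U)$ denotes the graph of an operator $U$. For $T\in LR(X,Y)$, $S\in LR(Y,Z)$, the product is $ST=\{(x,z):\exists y\in Y,\ (x,y)\in T,\ (y,z)\in S\}$. For a Hilbert space $X$, $X\times X$ carries the inner product $\langle(x_1,y_1),(x_2,y_2)\rangle=\langle x_1,x_2\rangle+\langle y_1,y_2\rangle$. For $T\in LR(X)$ closed ($T(0)$ is then closed): $T_\infty:=\{(0,g)\in X^2:(0,g)\in T\}$ and $T_s:=T\ominus T_\infty$ (the orthogonal complement of $T_\infty$ in $T$), so $T=T_s\oplus T_\infty$. $Q_T:X\to X/\overline{T(0)}$, $x\mapsto[x]$, is the quotient map, $Q_T|_{T(0)^\perp}$ is its restriction to $T(0)^\perp$, and $P_T:X\to\overline{T(0)}^\perp$ is the orthogonal projection. Define $\tilde T_s:=G(Q_T)\,T\in LR(X,X/\overline{T(0)})$ and $\hat T_s:=G(P_T)\,T\in LR(X)$. *)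

theory Defs
  imports "HOL-Analysis.Analysis"
begin

text \<open>
  The scalar field of a Hilbert space is \<open>\<real>\<close> or \<open>\<complex>\<close>. By the Gelfand--Mazur theorem these
  are, up to isomorphism, the only models of the following class, and the last axiom forces
  \<open>scalar_cnj\<close> to be the usual conjugation.
\<close>

class hilbert_scalar = real_normed_field +
  fixes scalar_cnj :: "'a \<Rightarrow> 'a"
  assumes scalar_cnj_add: "scalar_cnj (a + b) = scalar_cnj a + scalar_cnj b"
    and scalar_cnj_mult: "scalar_cnj (a * b) = scalar_cnj a * scalar_cnj b"
    and scalar_cnj_cnj: "scalar_cnj (scalar_cnj a) = a"
    and mult_scalar_cnj: "a * scalar_cnj a = (norm a)\<^sup>2 *\<^sub>R 1"

instantiation real :: hilbert_scalar
begin

definition scalar_cnj_real :: "real \<Rightarrow> real"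
  where "scalar_cnj_real a = a"

instance
  by standard (auto simp: scalar_cnj_real_def power2_eq_square)

end

instantiation complex :: hilbert_scalar
begin

definition scalar_cnj_complex :: "complex \<Rightarrow> complex"
  where "scalar_cnj_complex a = cnj a"

instance
  by standard (auto simp: scalar_cnj_complex_def complex_mult_cnj cmod_power2 scaleR_conv_of_real)

end

text \<open>
  A Hilbert space over \<open>'k\<close>, linear in the first argument of the inner product. Norm, topology
  and completeness are those of the type class \<open>banach\<close>; \<open>ip_norm\<close> says that the norm is the one
  induced by \<open>ip\<close>, and \<open>scale_of_real\<close> that the two scalar multiplications agree on the reals.
\<close>

locale hilbert_space = vector_space scale
  for scale :: "'k::hilbert_scalar \<Rightarrow> 'a::banach \<Rightarrow> 'a" +
  fixes ip :: "'a \<Rightarrow> 'a \<Rightarrow> 'k"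
  assumes scale_of_real: "scale (of_real r) x = r *\<^sub>R x"
    and ip_add_left: "ip (x + y) z = ip x z + ip y z"
    and ip_scale_left: "ip (scale c x) y = c * ip x y"
    and ip_cnj: "ip y x = scalar_cnj (ip x y)"
    and ip_norm: "ip x x = of_real ((norm x)\<^sup>2)"

lemma hilbert_space_real:
  "hilbert_space scaleR (inner :: 'a::{real_inner,banach} \<Rightarrow> 'a \<Rightarrow> real)"
  by unfold_locales
    (auto simp: algebra_simps inner_commute scalar_cnj_real_def power2_norm_eq_inner)

lemma hilbert_space_complex:
  "hilbert_space (*) (\<lambda>x y :: complex. x * cnj y)"
  by unfold_locales
    (auto simp: algebra_simps scaleR_conv_of_real scalar_cnj_complex_def
      complex_norm_square[symmetric])

text \<open>
  The norm that the library puts on \<open>'a \<times> 'a\<close> is the one induced by this inner product, so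
  \<open>closed T\<close> for \<open>T :: ('a \<times> 'a) set\<close> is closedness in the Hilbert space \<open>X \<times> X\<close>.
\<close>

definition ip_prod :: "('a \<Rightarrow> 'a \<Rightarrow> 'k::plus) \<Rightarrow> 'a \<times> 'a \<Rightarrow> 'a \<times> 'a \<Rightarrow> 'k"
  where "ip_prod ip v w = ip (fst v) (fst w) + ip (snd v) (snd w)"

definition LR :: "('k::comm_ring_1 \<Rightarrow> 'a::ab_group_add \<Rightarrow> 'a) \<Rightarrow> ('k \<Rightarrow> 'b::ab_group_add \<Rightarrow> 'b)
    \<Rightarrow> ('a \<times> 'b) set set"
  where "LR s1 s2 = {T. module.subspace (module_prod.scale s1 s2) T}"

text \<open>
  The graph of an operator \<open>f\<close> with domain \<open>D\<close>. The product \<open>ST\<close> of relations is \<open>T O S\<close>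
  (note the order), the inverse is \<open>T\<inverse>\<close>, and \<open>T(x)\<close> is \<open>T `` {x}\<close>.
\<close>

definition graph_op :: "'a set \<Rightarrow> ('a \<Rightarrow> 'b) \<Rightarrow> ('a \<times> 'b) set"
  where "graph_op D f = {(x, f x) | x. x \<in> D}"

definition orth_compl :: "('a \<Rightarrow> 'a \<Rightarrow> 'k::zero) \<Rightarrow> 'a set \<Rightarrow> 'a set"
  where "orth_compl ip M = {x. \<forall>m\<in>M. ip x m = 0}"

definition orth_proj :: "('a::minus \<Rightarrow> 'a \<Rightarrow> 'k::zero) \<Rightarrow> 'a set \<Rightarrow> 'a \<Rightarrow> 'a"
  where "orth_proj ip M x = (THE p. p \<in> M \<and> x - p \<in> orth_compl ip M)"

text \<open>
  Elements of a quotient space \<open>X/N\<close> are represented by the cosets \<open>x + N\<close>, as sets.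
\<close>

definition quot_map :: "'a::plus set \<Rightarrow> 'a \<Rightarrow> 'a set"
  where "quot_map N x = (\<lambda>n. x + n) ` N"

definition Q_map :: "('a::real_normed_vector \<times> 'a) set \<Rightarrow> 'a \<Rightarrow> 'a set"
  where "Q_map T = quot_map (closure (T `` {0}))"

definition P_map :: "('a \<Rightarrow> 'a \<Rightarrow> 'k::zero) \<Rightarrow> ('a::real_normed_vector \<times> 'a) set \<Rightarrow> 'a \<Rightarrow> 'a"
  where "P_map ip T = orth_proj ip (orth_compl ip (closure (T `` {0})))"

definition mul_part :: "('a::zero \<times> 'a) set \<Rightarrow> ('a \<times> 'a) set"
  where "mul_part T = {(0, g) | g. (0, g) \<in> T}"

definition op_part :: "('a \<Rightarrow> 'a \<Rightarrow> 'k::{zero,plus}) \<Rightarrow> ('a::zero \<times> 'a) set \<Rightarrow> ('a \<times> 'a) set"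
  where "op_part ip T = T \<inter> orth_compl (ip_prod ip) (mul_part T)"

definition tilde_part :: "('a::real_normed_vector \<times> 'a) set \<Rightarrow> ('a \<times> 'a set) set"
  where "tilde_part T = T O graph_op UNIV (Q_map T)"

definition hat_part :: "('a \<Rightarrow> 'a \<Rightarrow> 'k::zero) \<Rightarrow> ('a::real_normed_vector \<times> 'a) set
    \<Rightarrow> ('a \<times> 'a) set"
  where "hat_part ip T = T O graph_op UNIV (P_map ip T)"

end

theory Submission
  imports Defs
begin

text \<open>
  Write \<open>N = T(0)\<close>, a closed subspace because \<open>T\<close> is one. All three relations consist of the
  pairs \<open>(x, z) \<in> T\<close> with \<open>z \<in> N\<^sup>\<bottom>\<close>. For \<open>op_part\<close> this is immediate, since the first
  component of an element of \<open>mul_part T\<close> is zero. For the other two the point is that the set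
  \<open>T(x)\<close> is a union of cosets of \<open>N\<close>: passing from \<open>(x, y) \<in> T\<close> to \<open>(x, z)\<close> with \<open>y - z \<in> N\<close>
  does not leave \<open>T\<close>. The operator \<open>P_T\<close> selects the element of \<open>y + N\<close> that lies in \<open>N\<^sup>\<bottom>\<close>, and so
  does \<open>Q_T\<close> followed by the inverse of its restriction to \<open>N\<^sup>\<bottom>\<close>.

  Only for \<open>P_T\<close> must such an element be known to exist. This is the projection theorem for
  \<open>N\<close> (\<open>orthogonal_decomposition\<close>), proved here for an arbitrary scalar field of the class
  \<open>hilbert_scalar\<close>: the parallelogram law makes a minimising sequence for the distance to \<open>N\<close>
  converge (\<open>nearest_point_exists\<close>), and a nearest point leaves an orthogonal remainder
  (\<open>orthogonal_if_norm_minimal\<close>).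
\<close>

section \<open>Inner products over a general scalar field\<close>

text \<open>
  Conjugation fixes the reals because \<open>r * scalar_cnj r = r\<^sup>2\<close>, where \<open>r \<noteq> 0\<close> cancels.
\<close>

lemma scalar_cnj_of_real [simp]: "scalar_cnj (of_real r :: 'k::hilbert_scalar) = of_real r"
proof (cases "r = 0")
  case True
  have "scalar_cnj (0 :: 'k) + scalar_cnj 0 = scalar_cnj 0"
    by (metis scalar_cnj_add add_0)
  with True show ?thesis by simp
next
  case False
  have "(of_real r :: 'k) * scalar_cnj (of_real r) = of_real r * of_real r"
    by (simp add: mult_scalar_cnj scaleR_conv_of_real power2_eq_square flip: of_real_mult)
  with False show ?thesis by simp
qed

lemma scalar_cnj_0 [simp]: "scalar_cnj (0 :: 'k::hilbert_scalar) = 0"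
  using scalar_cnj_of_real[of 0, where 'k = 'k] by (simp del: scalar_cnj_of_real)

context hilbert_space
begin

lemma ip_add_right: "ip x (y + z) = ip x y + ip x z"
  by (metis ip_cnj ip_add_left scalar_cnj_add)

lemma ip_scale_right: "ip x (scale c y) = scalar_cnj c * ip x y"
  by (metis ip_cnj ip_scale_left scalar_cnj_mult)

lemma ip_zero_left [simp]: "ip 0 y = 0"
  using ip_add_left[of 0 0 y] by simp

lemma ip_zero_right [simp]: "ip x 0 = 0"
  using ip_add_right[of x 0 0] by simp

lemma ip_diff_left: "ip (x - y) z = ip x z - ip y z"
  using ip_add_left[of "x - y" y z] by (simp add: algebra_simps)

lemma ip_diff_right: "ip x (y - z) = ip x y - ip x z"
  using ip_add_right[of x "y - z" z] by (simp add: algebra_simps)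

lemma ip_self_eq_0_iff: "ip x x = 0 \<longleftrightarrow> x = 0"
  by (simp add: ip_norm)

lemma parallelogram_law:
  fixes u v :: 'a
  shows "(norm (u + v))\<^sup>2 + (norm (u - v))\<^sup>2 = 2 * (norm u)\<^sup>2 + 2 * (norm v)\<^sup>2"
proof -
  have "ip (u + v) (u + v) + ip (u - v) (u - v) = 2 * ip u u + 2 * ip v v"
    by (simp add: ip_add_left ip_add_right ip_diff_left ip_diff_right)
  then have "(of_real ((norm (u + v))\<^sup>2 + (norm (u - v))\<^sup>2) :: 'k)
      = of_real (2 * (norm u)\<^sup>2 + 2 * (norm v)\<^sup>2)"
    by (simp add: ip_norm)
  then show ?thesis by (simp only: of_real_eq_iff)
qed

section \<open>The projection theorem\<close>

text \<open>
  The midpoint of two points \<open>b\<close> and \<open>c\<close> of \<open>C\<close> lies in \<open>C\<close>, so it is no closer to \<open>x\<close> than the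
  infimum allows. If \<open>b\<close> and \<open>c\<close> both nearly attain the infimum, the parallelogram law for
  \<open>x - b\<close> and \<open>x - c\<close> therefore forces \<open>b\<close> and \<open>c\<close> to be close to each other. Hence minimising
  sequences are Cauchy. It is convenient to minimise the square of the distance.
\<close>

lemma nearest_point_exists:
  fixes C :: "'a set"
  assumes "closed C" "convex C" "C \<noteq> {}"
  obtains p where "p \<in> C" "\<And>c. c \<in> C \<Longrightarrow> norm (x - p) \<le> norm (x - c)"
proof -
  define D where "D = (INF c\<in>C. (norm (x - c))\<^sup>2)"
  have bdd: "bdd_below ((\<lambda>c. (norm (x - c))\<^sup>2) ` C)"
    by (rule bdd_belowI2[of _ 0]) simp
  have D_le: "D \<le> (norm (x - c))\<^sup>2" if "c \<in> C" for c
    unfolding D_def using bdd that by (rule cINF_lower)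
  have "\<exists>c\<in>C. (norm (x - c))\<^sup>2 < D + 1 / real (Suc n)" for n
    using cINF_less_iff[OF assms(3) bdd, of "D + 1 / real (Suc n)"] by (simp add: D_def)
  then obtain f where f: "\<And>n. f n \<in> C" "\<And>n. (norm (x - f n))\<^sup>2 < D + 1 / real (Suc n)"
    by metis
  have close: "(norm (b - c))\<^sup>2 \<le> 2 * ((norm (x - b))\<^sup>2 - D) + 2 * ((norm (x - c))\<^sup>2 - D)"
    if "b \<in> C" "c \<in> C" for b c
  proof -
    have "(1/2) *\<^sub>R b + (1/2) *\<^sub>R c \<in> C"
      using assms(2) that by (auto simp: convex_def)
    then have "D \<le> (norm (x - ((1/2) *\<^sub>R b + (1/2) *\<^sub>R c)))\<^sup>2" by (rule D_le)
    moreover have "(x - b) + (x - c) = 2 *\<^sub>R (x - ((1/2) *\<^sub>R b + (1/2) *\<^sub>R c))"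
      by (simp add: algebra_simps scaleR_2)
    then have "(norm ((x - b) + (x - c)))\<^sup>2 = 4 * (norm (x - ((1/2) *\<^sub>R b + (1/2) *\<^sub>R c)))\<^sup>2"
      by (simp only: norm_scaleR power_mult_distrib) simp
    moreover have "norm ((x - b) - (x - c)) = norm (b - c)"
      by (simp add: norm_minus_commute)
    ultimately show ?thesis
      using parallelogram_law[of "x - b" "x - c"] by simp
  qed
  have "Cauchy f"
  proof (rule metric_CauchyI)
    fix e :: real
    assume "0 < e"
    then obtain M where M: "inverse (real (Suc M)) < e\<^sup>2 / 4"
      using reals_Archimedean[of "e\<^sup>2 / 4"] by auto
    have small: "(norm (x - f n))\<^sup>2 - D < e\<^sup>2 / 4" if "M \<le> n" for n
    proof -
      have "1 / real (Suc n) \<le> inverse (real (Suc M))"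
        using that by (simp add: field_simps)
      with f(2)[of n] M show ?thesis by linarith
    qed
    have "dist (f m) (f n) < e" if "M \<le> m" "M \<le> n" for m n
    proof (rule power_less_imp_less_base)
      show "(dist (f m) (f n))\<^sup>2 < e\<^sup>2"
        using close[OF f(1) f(1), of m n] small[OF that(1)] small[OF that(2)]
        by (simp add: dist_norm)
    qed (use \<open>0 < e\<close> in simp)
    then show "\<exists>M. \<forall>m\<ge>M. \<forall>n\<ge>M. dist (f m) (f n) < e" by blast
  qed
  then obtain p where p: "f \<longlonglongrightarrow> p"
    using Cauchy_convergent convergent_def by blast
  show thesis
  proof (rule that)
    show "p \<in> C"
      using assms(1) f(1) p by (rule closed_sequentially)
    fix c
    assume "c \<in> C"
    have "(\<lambda>n. (norm (x - f n))\<^sup>2) \<longlonglongrightarrow> (norm (x - p))\<^sup>2"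
      by (intro tendsto_power tendsto_norm tendsto_diff tendsto_const p)
    moreover have "(\<lambda>n. D + 1 / real (Suc n)) \<longlonglongrightarrow> D + 0"
      using tendsto_add[OF tendsto_const LIMSEQ_inverse_real_of_nat]
      by (simp only: inverse_eq_divide)
    ultimately have "(norm (x - p))\<^sup>2 \<le> D + 0"
      by (rule LIMSEQ_le) (meson f(2) less_imp_le)
    with D_le[OF \<open>c \<in> C\<close>] have "(norm (x - p))\<^sup>2 \<le> (norm (x - c))\<^sup>2" by linarith
    then show "norm (x - p) \<le> norm (x - c)"
      by (rule power2_le_imp_le) simp
  qed
qed

text \<open>
  Subtracting from \<open>y\<close> its component \<open>c n\<close> along \<open>n\<close>, where \<open>c = ip y n / (norm n)\<^sup>2\<close>, lowers
  \<open>(norm y)\<^sup>2\<close> by \<open>(norm (ip y n))\<^sup>2 / (norm n)\<^sup>2\<close>.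
\<close>

lemma orthogonal_if_norm_minimal:
  assumes "\<And>c. norm y \<le> norm (y - scale c n)"
  shows "ip y n = 0"
proof (cases "n = 0")
  case False
  define t where "t = 1 / (norm n)\<^sup>2"
  have t: "t * (norm n)\<^sup>2 = 1" "0 < t"
    using False by (simp_all add: t_def)
  let ?a = "ip y n"
  let ?c = "of_real t * ?a"
  have aa: "?a * scalar_cnj ?a = of_real ((norm ?a)\<^sup>2)"
    by (simp add: mult_scalar_cnj scaleR_conv_of_real)
  have nn: "of_real t * ip n n = 1"
    by (simp only: ip_norm t flip: of_real_mult) simp
  have "ip (y - scale ?c n) (y - scale ?c n)
      = ip y y - of_real t * (?a * scalar_cnj ?a) - of_real t * (?a * scalar_cnj ?a)
        + of_real t * (?a * scalar_cnj ?a) * (of_real t * ip n n)"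
    by (simp add: ip_diff_left ip_diff_right ip_scale_left ip_scale_right scalar_cnj_mult
        ip_cnj[of n y] algebra_simps)
  then have "ip (y - scale ?c n) (y - scale ?c n) = ip y y - of_real t * (?a * scalar_cnj ?a)"
    unfolding nn by simp
  then have "(of_real ((norm (y - scale ?c n))\<^sup>2) :: 'k)
      = of_real ((norm y)\<^sup>2 - t * (norm ?a)\<^sup>2)"
    by (simp only: ip_norm aa of_real_diff of_real_mult)
  then have "(norm (y - scale ?c n))\<^sup>2 = (norm y)\<^sup>2 - t * (norm ?a)\<^sup>2"
    by (simp only: of_real_eq_iff)
  moreover have "(norm y)\<^sup>2 \<le> (norm (y - scale ?c n))\<^sup>2"
    using assms by (intro power_mono) auto
  ultimately have "t * (norm ?a)\<^sup>2 \<le> 0" by linarith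
  with t(2) show ?thesis by (simp add: mult_le_0_iff)
qed simp

lemma subspace_convex:
  assumes "subspace N"
  shows "convex N"
  unfolding convex_def
  by (metis assms scale_of_real subspace_add subspace_scale)

lemma orthogonal_decomposition:
  assumes "subspace N" "closed N"
  obtains q where "x - q \<in> N" "q \<in> orth_compl ip N"
proof -
  have "N \<noteq> {}" using subspace_0[OF assms(1)] by auto
  then obtain p where p: "p \<in> N" "\<And>c. c \<in> N \<Longrightarrow> norm (x - p) \<le> norm (x - c)"
    using nearest_point_exists[OF assms(2) subspace_convex[OF assms(1)]] by metis
  have "ip (x - p) n = 0" if "n \<in> N" for n
  proof (rule orthogonal_if_norm_minimal)
    fix c
    have "p + scale c n \<in> N"
      using assms(1) p(1) that by (simp add: subspace_add subspace_scale)
    then show "norm (x - p) \<le> norm (x - p - scale c n)"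
      using p(2) by (simp add: diff_diff_eq)
  qed
  with p(1) show thesis
    by (intro that[of "x - p"]) (auto simp: orth_compl_def)
qed

text \<open>
  The difference of two candidates for the projection onto \<open>N\<^sup>\<bottom>\<close> lies both in \<open>N\<^sup>\<bottom>\<close> and in
  \<open>N\<^sup>\<bottom>\<^sup>\<bottom>\<close>, hence is orthogonal to itself. Since \<open>N \<subseteq> N\<^sup>\<bottom>\<^sup>\<bottom>\<close>, any \<open>q \<in> N\<^sup>\<bottom>\<close> with \<open>x - q \<in> N\<close> is
  such a candidate.
\<close>

lemma orth_proj_orth_compl_eqI:
  assumes "x - q \<in> N" "q \<in> orth_compl ip N"
  shows "orth_proj ip (orth_compl ip N) x = q"
  unfolding orth_proj_def
proof (rule the_equality)
  have "ip (x - q) m = 0" if "m \<in> orth_compl ip N" for m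
  proof -
    have "ip m (x - q) = 0" using that assms(1) by (simp add: orth_compl_def)
    then show ?thesis using ip_cnj[of "x - q" m] by simp
  qed
  then have xq: "x - q \<in> orth_compl ip (orth_compl ip N)" by (simp add: orth_compl_def)
  with assms(2) show "q \<in> orth_compl ip N \<and> x - q \<in> orth_compl ip (orth_compl ip N)"
    by simp
  fix r
  assume r: "r \<in> orth_compl ip N \<and> x - r \<in> orth_compl ip (orth_compl ip N)"
  have "r - q \<in> orth_compl ip N"
    using r assms(2) by (simp add: orth_compl_def ip_diff_left)
  then have "ip (x - q) (r - q) = 0" "ip (x - r) (r - q) = 0"
    using r xq by (simp_all only: orth_compl_def mem_Collect_eq)
  then have "ip ((x - q) - (x - r)) (r - q) = 0" by (simp only: ip_diff_left diff_self)
  then show "r = q" by (simp add: ip_self_eq_0_iff)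
qed

section \<open>The operator part of a closed linear relation\<close>

lemma quot_map_eq_iff:
  assumes "subspace N"
  shows "quot_map N y = quot_map N z \<longleftrightarrow> y - z \<in> N"
proof
  assume "quot_map N y = quot_map N z"
  moreover have "y + 0 \<in> quot_map N y"
    unfolding quot_map_def using subspace_0[OF assms] by (rule imageI)
  ultimately show "y - z \<in> N" by (auto simp: quot_map_def)
next
  assume *: "y - z \<in> N"
  have sub: "quot_map N a \<subseteq> quot_map N b" if "a - b \<in> N" for a b
  proof
    fix w
    assume "w \<in> quot_map N a"
    then obtain n where "n \<in> N" "w = a + n" by (auto simp: quot_map_def)
    then have "(a - b) + n \<in> N" "w = b + ((a - b) + n)"
      using subspace_add[OF assms that] by simp_all
    then show "w \<in> quot_map N b" unfolding quot_map_def by blast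
  qed
  have "z - y \<in> N" using subspace_neg[OF assms *] by simp
  with * show "quot_map N y = quot_map N z" by (intro equalityI sub)
qed

end

theorem theorem2p2:
  fixes scale :: "'k::hilbert_scalar \<Rightarrow> 'a::banach \<Rightarrow> 'a"
    and ip :: "'a \<Rightarrow> 'a \<Rightarrow> 'k"
    and T :: "('a \<times> 'a) set"
  assumes "hilbert_space scale ip"
    and "T \<in> LR scale scale"
    and "closed T"
  shows "op_part ip T = hat_part ip T
    \<and> hat_part ip T = tilde_part T O (graph_op (orth_compl ip (T `` {0})) (Q_map T))\<inverse>"
proof -
  interpret hilbert_space scale ip by fact
  interpret P: module_prod scale scale by unfold_locales
  have T: "P.p.subspace T" using assms(2) by (simp add: LR_def)
  define N where "N = T `` {0}"
  have T0: "(0, n) \<in> T \<longleftrightarrow> n \<in> N" for n by (simp add: N_def)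
  have subN: "subspace N"
  proof (rule subspaceI)
    show "0 \<in> N" using P.p.subspace_0[OF T] by (simp add: N_def zero_prod_def)
    show "x + y \<in> N" if "x \<in> N" "y \<in> N" for x y
      using P.p.subspace_add[OF T, of "(0, x)" "(0, y)"] that by (simp add: N_def)
    show "scale c x \<in> N" if "x \<in> N" for c x
      using P.p.subspace_scale[OF T, of "(0, x)" c] that by (simp add: N_def P.scale_def)
  qed
  have "N = Pair 0 -` T" by (auto simp: N_def)
  then have clN: "closed N"
    using assms(3) by (auto intro!: continuous_closed_vimage continuous_intros)
  then have Q: "Q_map T = quot_map N" and P: "P_map ip T = orth_proj ip (orth_compl ip N)"
    by (simp_all add: Q_map_def P_map_def flip: N_def)
  \<comment> \<open>\<open>T(x)\<close> is a union of cosets of \<open>N\<close>: subtract \<open>(0, y - z) \<in> T\<close>.\<close>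
  have shift: "(x, z) \<in> T" if "(x, y) \<in> T" "y - z \<in> N" for x y z
    using P.p.subspace_diff[OF T that(1), of "(0, y - z)"] that(2) by (simp add: T0)
  \<comment> \<open>The common value of the three relations.\<close>
  define R where "R = {(x, z) \<in> T. z \<in> orth_compl ip N}"
  have "op_part ip T = R"
    by (auto simp: op_part_def mul_part_def ip_prod_def orth_compl_def R_def T0)
  moreover have "hat_part ip T = R"
  proof (intro equalityI subrelI)
    fix x z
    assume "(x, z) \<in> hat_part ip T"
    then obtain y where y: "(x, y) \<in> T" "z = orth_proj ip (orth_compl ip N) y"
      by (auto simp: hat_part_def graph_op_def P)
    obtain q where q: "y - q \<in> N" "q \<in> orth_compl ip N"
      using orthogonal_decomposition[OF subN clN] by blast
    then have "z = q" using y(2) by (simp add: orth_proj_orth_compl_eqI)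
    with q y(1) show "(x, z) \<in> R" by (auto simp: R_def intro: shift)
  next
    fix x z
    assume "(x, z) \<in> R"
    then have "(x, z) \<in> T" "z \<in> orth_compl ip N" by (simp_all add: R_def)
    moreover from this have "orth_proj ip (orth_compl ip N) z = z"
      by (intro orth_proj_orth_compl_eqI) (simp_all add: subspace_0[OF subN])
    ultimately show "(x, z) \<in> hat_part ip T"
      by (force simp: hat_part_def graph_op_def P)
  qed
  moreover have "tilde_part T O (graph_op (orth_compl ip N) (quot_map N))\<inverse> = R"
  proof (intro equalityI subrelI)
    fix x z
    assume "(x, z) \<in> tilde_part T O (graph_op (orth_compl ip N) (quot_map N))\<inverse>"
    then obtain y where "(x, y) \<in> T" "quot_map N y = quot_map N z" "z \<in> orth_compl ip N"
      by (auto simp: tilde_part_def graph_op_def Q)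
    then show "(x, z) \<in> R"
      by (auto simp: R_def quot_map_eq_iff[OF subN] intro: shift)
  next
    fix x z
    assume "(x, z) \<in> R"
    then show "(x, z) \<in> tilde_part T O (graph_op (orth_compl ip N) (quot_map N))\<inverse>"
      by (force simp: R_def tilde_part_def graph_op_def Q)
  qed
  ultimately show ?thesis by (simp add: Q flip: N_def)
qed

end
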